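(* Let $\alpha\in(0,1/2]$ and consider the model D-EX-N$(\zeta_n)$ described in the context with $\lim_{n\to\infty}\zeta_n=1$, and write $\operatorname{FDR}_\infty(1)=\operatorname{FDR}_\infty(1;\rho)$ for its dependence on $\rho$. Then \[ \lim_{\rho\to0^+}\operatorname{FDR}_\infty(1;\rho)=\Phi\big(-\sqrt{-2\ln(\alpha)}\big). \]
   Context: Model D-EX-N$(\zeta_n)$ with correlation $\rho\in(0,1)$: $\Phi$ is the standard normal c.d.f.; $X_0,X_1,\dots,X_n$ are i.i.d. $N(0,1)$; for $H_i:\vartheta_i=0$ vs $K_i:\vartheta_i>0$, $T_i=\vartheta_i+\sqrt{1-\rho}\,X_i-\sqrt\rho\,X_0$ and $p_i=1-\Phi(T_i)$, where $\vartheta_i=\infty$ is allowed and gives $p_i=0$ a.s. For each $n$, exactly $n_0$ hypotheses are true ($\vartheta_i=0$), $\zeta_n=n_0/n$, and the rest have $\vartheta_i=\infty$. The linear step-up procedure at level $\alpha$ rejects all $H_i$ with $p_i\le m\alpha/n$, $m=\max\{i:p_{i:n}\le i\alpha/n\}$ ($p_{1:n}\le\dots\le p_{n:n}$ ordered $p$-values; nothing rejected if no such $i$). $V_n$ = number of rejected true hypotheses, $R_n$ = number of rejections, and $\operatorname{FDR}_\infty(1)=\lim_{n\to\infty}\mathbb E[V_n/(R_n\vee1)]$. *)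

theory Defs
  imports "HOL-Probability.Probability"
begin

definition Phi :: "real \<Rightarrow> real" where
  "Phi x = cdf (density lborel std_normal_density) x"

text \<open>p-values of the model D-EX-N: hypotheses are indexed by 1..n; the indices in
  the set T are the true hypotheses (theta_i = 0), all others have theta_i = infinity,
  hence p_i = 0.  X 0 is the common factor X_0.\<close>
definition pval :: "real \<Rightarrow> nat set \<Rightarrow> (nat \<Rightarrow> 'a \<Rightarrow> real) \<Rightarrow> nat \<Rightarrow> 'a \<Rightarrow> real" where
  "pval \<rho> T X i \<omega> =
     (if i \<in> T then 1 - Phi (sqrt (1 - \<rho>) * X i \<omega> - sqrt \<rho> * X 0 \<omega>) else 0)"

definition ordered_p :: "nat \<Rightarrow> (nat \<Rightarrow> real) \<Rightarrow> nat \<Rightarrow> real" where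
  "ordered_p n p i = sort (map p [1..<n+1]) ! (i - 1)"

definition su_index :: "real \<Rightarrow> nat \<Rightarrow> (nat \<Rightarrow> real) \<Rightarrow> nat" where
  "su_index \<alpha> n p = Max ({i \<in> {1..n}. ordered_p n p i \<le> real i * \<alpha> / real n} \<union> {0})"

definition su_rejected :: "real \<Rightarrow> nat \<Rightarrow> (nat \<Rightarrow> real) \<Rightarrow> nat set" where
  "su_rejected \<alpha> n p =
     (let m = su_index \<alpha> n p in
      if m = 0 then {} else {i \<in> {1..n}. p i \<le> real m * \<alpha> / real n})"

definition FDR :: "'a measure \<Rightarrow> (nat \<Rightarrow> 'a \<Rightarrow> real) \<Rightarrow> real \<Rightarrow> real \<Rightarrow> nat \<Rightarrow> nat set \<Rightarrow> real" where
  "FDR M X \<alpha> \<rho> n T =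
     (\<integral>\<omega>. (let R = su_rejected \<alpha> n (\<lambda>i. pval \<rho> T X i \<omega>) in
            real (card (R \<inter> T)) / real (max (card R) 1)) \<partial>M)"

end

theory Submission
  imports Defs "HOL-Real_Asymp.Real_Asymp"
begin

text \<open>
  Write \<open>Q = 1 - Phi\<close>. Given \<open>X\<^sub>0 = x\<close>, a positive fraction of the hypotheses is rejected, and the
  false discovery proportion tends to \<open>1\<close>, if \<open>Q ((a + sqrt \<rho> * x) / sqrt (1 - \<rho>)) > Q a / \<alpha>\<close>
  for some \<open>a\<close>. Otherwise, up to one critical \<open>x\<close>, it tends to \<open>0\<close>. The set of such \<open>x\<close> is a down-set, so
  the limit is \<open>Phi x\<^sub>\<rho>\<close> with \<open>x\<^sub>\<rho>\<close> its supremum. Everything is monotone in \<open>X\<^sub>0\<close>, so it suffices to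
  compare with fixed values of \<open>X\<^sub>0\<close> slightly below and above \<open>x\<^sub>\<rho>\<close>, and no conditioning is needed.

  To locate \<open>x\<^sub>\<rho>\<close> put \<open>x = - y\<close> and \<open>b = (a - sqrt \<rho> * y) / sqrt (1 - \<rho>)\<close>. Then
  \<open>a\<^sup>2 - b\<^sup>2 \<le> y\<^sup>2\<close> with equality at \<open>a = y / sqrt \<rho>\<close>, and Mills ratio bounds give
  \<open>Q b / Q a \<approx> exp ((a\<^sup>2 - b\<^sup>2) / 2)\<close> uniformly as \<open>\<rho> \<rightarrow> 0\<close>. Hence the transition happens where
  \<open>exp (y\<^sup>2 / 2) = 1 / \<alpha>\<close>.
\<close>

section \<open>The normal tail\<close>

text \<open>Differences of the c.d.f. are integrals of the continuous density, so the fundamental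
  theorem of calculus applies.\<close>

lemma Phi_has_real_derivative: "(Phi has_real_derivative std_normal_density x) (at x)"
proof -
  interpret N: prob_space "density lborel std_normal_density"
    by (rule prob_space_normal_density) simp
  interpret N: real_distribution "density lborel std_normal_density"
    by unfold_locales auto
  have cont: "continuous_on S std_normal_density" for S
    unfolding normal_density_def by (intro continuous_intros) auto
  have diff: "Phi y - Phi a = integral {a..y} std_normal_density" if "a < y" for a y
  proof -
    have int: "integrable lborel (std_normal_density :: real \<Rightarrow> real)"
      by (rule integrable_normal_density) simp
    have "Phi y - Phi a = measure (density lborel std_normal_density) {a<..y}"
      unfolding Phi_def by (rule N.cdf_diff_eq[OF that])
    also have "\<dots> = (\<integral>x. indicator {a<..y} x \<partial>density lborel std_normal_density)"
      by simp
    also have "\<dots> = (\<integral>x. std_normal_density x * indicator {a<..y} x \<partial>lborel)"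
      by (subst integral_real_density) auto
    \<comment> \<open>The half-open interval of the c.d.f. and the closed one of the integral differ
      only by the null set \<open>{a}\<close>.\<close>
    also have "\<dots> = (\<integral>x. indicator {a..y} x *\<^sub>R std_normal_density x \<partial>lborel)"
      by (intro integral_cong_AE)
        (auto intro!: AE_I[where N = "{a}"] split: split_indicator)
    also have "\<dots> = integral {a..y} std_normal_density"
      unfolding set_lebesgue_integral_def[symmetric]
      by (rule set_borel_integral_eq_integral, unfold set_integrable_def,
          rule integrable_mult_indicator) (simp_all add: int)
    finally show ?thesis .
  qed
  \<comment> \<open>Starting the integral at \<open>x - 1\<close> makes \<open>x\<close> an interior
    point, so the one-interval derivative is a full derivative.\<close>
  have "((\<lambda>y. integral {x-1..y} std_normal_density) has_real_derivative std_normal_density x)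
      (at x within {x-1..x+1})"
    by (rule integral_has_real_derivative[OF cont]) auto
  hence "((\<lambda>y. integral {x-1..y} std_normal_density) has_real_derivative std_normal_density x) (at x)"
    by (subst (asm) at_within_interior) auto
  hence "((\<lambda>y. Phi (x-1) + integral {x-1..y} std_normal_density)
      has_real_derivative std_normal_density x) (at x)"
    by (auto intro!: derivative_eq_intros)
  moreover have "eventually (\<lambda>y. Phi (x-1) + integral {x-1..y} std_normal_density = Phi y) (nhds x)"
    using eventually_nhds_in_open[of "{x-1<..}" x]
    by (auto elim!: eventually_mono simp flip: diff)
  ultimately show ?thesis
    by (subst (asm) DERIV_cong_ev[OF refl _ refl]) auto
qed

lemma isCont_Phi: "isCont Phi x"
  by (rule DERIV_isCont[OF Phi_has_real_derivative])

lemma Phi_less: "x < y \<Longrightarrow> Phi x < Phi y"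
  by (rule DERIV_pos_imp_increasing[of x y Phi])
    (auto intro!: exI Phi_has_real_derivative normal_density_pos)

lemma Phi_at_top: "(Phi \<longlongrightarrow> 1) at_top"
  and Phi_at_bot: "(Phi \<longlongrightarrow> 0) at_bot"
proof -
  interpret N: prob_space "density lborel std_normal_density"
    by (rule prob_space_normal_density) simp
  interpret N: real_distribution "density lborel std_normal_density"
    by unfold_locales auto
  show "(Phi \<longlongrightarrow> 1) at_top" "(Phi \<longlongrightarrow> 0) at_bot"
    using N.cdf_lim_at_top_prob N.cdf_lim_at_bot by (simp_all add: Phi_def[abs_def])
qed

lemma Phi_less_1: "Phi x < 1"
  and Phi_pos: "0 < Phi x"
proof -
  have "Phi x < Phi (x + 1)" "Phi (x - 1) < Phi x" by (simp_all add: Phi_less)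
  moreover have "Phi (x + 1) \<le> 1" "0 \<le> Phi (x - 1)"
    using tendsto_lowerbound[OF Phi_at_top eventually_mono[OF eventually_ge_at_top[of "x+1"]]]
      tendsto_upperbound[OF Phi_at_bot eventually_mono[OF eventually_le_at_bot[of "x-1"]]] Phi_less
    by (metis trivial_limit_at_top_linorder trivial_limit_at_bot_linorder order.order_iff_strict)+
  ultimately show "Phi x < 1" "0 < Phi x" by linarith+
qed

text \<open>By symmetry of the density \<open>Phi x + Phi (- x)\<close> has derivative zero; its
  constant value is read off at infinity.\<close>

lemma Phi_0: "Phi 0 = 1/2"
proof -
  have "((\<lambda>x. Phi x + Phi (- x)) has_real_derivative 0) (at x)" for x
    by (auto intro!: derivative_eq_intros DERIV_chain'[OF _ Phi_has_real_derivative, of uminus]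
        Phi_has_real_derivative simp: normal_density_def)
  hence "Phi x + Phi (- x) = Phi 0 + Phi (- 0)" for x
    using DERIV_isconst_all[of "\<lambda>x. Phi x + Phi (- x)" x 0] by blast
  hence "((\<lambda>x. Phi x + Phi (- x)) \<longlongrightarrow> 2 * Phi 0) at_top"
    by simp
  moreover have "((\<lambda>x. Phi x + Phi (- x)) \<longlongrightarrow> 1 + 0) at_top"
    by (intro tendsto_add Phi_at_top filterlim_compose[OF Phi_at_bot filterlim_uminus_at_bot_at_top])
  ultimately show ?thesis
    using tendsto_unique[of "at_top :: real filter"] by fastforce
qed

text \<open>This is the map from a test statistic to its p-value. It is strictly decreasing, which
  turns comparisons of p-values into comparisons of statistics.\<close>

definition gauss_tail :: "real \<Rightarrow> real" where
  "gauss_tail a = 1 - Phi a"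

lemma gauss_tail_derivative:
  "(gauss_tail has_real_derivative - std_normal_density x) (at x)"
  unfolding gauss_tail_def[abs_def]
  by (auto intro!: derivative_eq_intros Phi_has_real_derivative)

lemma gauss_tail_pos: "0 < gauss_tail x"
  by (simp add: gauss_tail_def Phi_less_1)

lemma gauss_tail_less_1: "gauss_tail x < 1"
  by (simp add: gauss_tail_def Phi_pos)

lemma gauss_tail_less_iff: "gauss_tail x < gauss_tail y \<longleftrightarrow> y < x"
  and gauss_tail_le_iff: "gauss_tail x \<le> gauss_tail y \<longleftrightarrow> y \<le> x"
  using Phi_less[of x y] Phi_less[of y x]
  by (cases x y rule: linorder_cases; simp add: gauss_tail_def)+

lemma gauss_tail_at_top: "(gauss_tail \<longlongrightarrow> 0) at_top"
  and gauss_tail_at_bot: "(gauss_tail \<longlongrightarrow> 1) at_bot"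
  using tendsto_diff[OF tendsto_const[of 1] Phi_at_top] tendsto_diff[OF tendsto_const[of 1] Phi_at_bot]
  by (simp_all add: gauss_tail_def[abs_def])

lemma gauss_tail_measurable [measurable]: "gauss_tail \<in> borel_measurable borel"
  by (intro borel_measurable_continuous_onI continuous_at_imp_continuous_on ballI
      DERIV_isCont[OF gauss_tail_derivative])

lemma gauss_tail_surj:
  assumes "0 < t" "t < 1"
  obtains a where "gauss_tail a = t"
proof -
  obtain u where u: "gauss_tail u < t"
    using order_tendstoD(2)[OF gauss_tail_at_top assms(1)] by (auto simp: eventually_at_top_linorder)
  obtain l where l: "t < gauss_tail l"
    using order_tendstoD(1)[OF gauss_tail_at_bot assms(2)] by (auto simp: eventually_at_bot_linorder)
  have "l \<le> u" using u l gauss_tail_less_iff[of u l] by linarith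
  then have "\<exists>a\<ge>l. a \<le> u \<and> gauss_tail a = t"
    using u l by (intro IVT2) (auto intro: DERIV_isCont[OF gauss_tail_derivative])
  thus ?thesis using that by blast
qed

section \<open>Mills ratio bounds and integrability of the reciprocal tail\<close>

lemma std_normal_density_derivative:
  "(std_normal_density has_real_derivative - x * std_normal_density x) (at x)"
  unfolding normal_density_def
  by (auto intro!: derivative_eq_intros simp: field_simps power2_eq_square)

text \<open>The difference \<open>?D\<close> decreases strictly to 0 at infinity, hence is positive.
  The denominator \<open>t + 2\<close> is not sharp, but it keeps the bound valid down to
  \<open>- 1\<close>, which is needed because the shifted argument \<open>b\<close> may be
  negative.\<close>

lemma gauss_tail_ge:
  assumes "- 1 \<le> t"
  shows "std_normal_density t \<le> (t + 2) * gauss_tail t"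
proof -
  let ?D = "\<lambda>t. gauss_tail t - std_normal_density t / (t + 2)"
  have "0 < ?D t"
  proof (rule DERIV_neg_imp_decreasing_at_top[where f = ?D])
    fix x assume x: "t \<le> x"
    have "(?D has_real_derivative - std_normal_density x -
        (- x * std_normal_density x * (x + 2) - std_normal_density x * 1) / ((x + 2) * (x + 2))) (at x)"
      using x assms
      by (intro DERIV_diff DERIV_divide gauss_tail_derivative std_normal_density_derivative)
        (auto intro!: derivative_eq_intros)
    also have "- std_normal_density x - (- x * std_normal_density x * (x + 2) -
        std_normal_density x * 1) / ((x + 2) * (x + 2))
        = std_normal_density x * (1 - 2 * (x + 2)) / (x + 2)\<^sup>2"
    proof -
      have "x + 2 \<noteq> 0" using x assms by simp
      thus ?thesis
        by (simp add: divide_simps power2_eq_square) (simp add: algebra_simps)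
    qed
    finally have "(?D has_real_derivative
        std_normal_density x * (1 - 2 * (x + 2)) / (x + 2)\<^sup>2) (at x)" .
    moreover have "std_normal_density x * (1 - 2 * (x + 2)) / (x + 2)\<^sup>2 < 0"
      using x assms by (intro divide_neg_pos mult_pos_neg normal_density_pos) auto
    ultimately show "\<exists>y. (?D has_real_derivative y) (at x) \<and> y < 0" by blast
  next
    have "((\<lambda>t. std_normal_density t / (t + 2)) \<longlongrightarrow> 0) at_top"
      unfolding std_normal_density_def by real_asymp
    from tendsto_diff[OF gauss_tail_at_top this]
    show "(?D \<longlongrightarrow> 0) at_top" by simp
  qed
  thus ?thesis using assms by (simp add: field_simps)
qed

lemma gauss_tail_le:
  assumes "0 \<le> t"
  shows "t * gauss_tail t \<le> std_normal_density t"
proof (cases "t = 0")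
  case False
  with assms have t: "t > 0" by simp
  let ?D = "\<lambda>t. gauss_tail t - std_normal_density t / t"
  have "0 < - ?D t"
  proof (rule DERIV_neg_imp_decreasing_at_top[where f = "\<lambda>t. - ?D t"])
    fix x assume x: "t \<le> x"
    have "((\<lambda>t. - ?D t) has_real_derivative - (std_normal_density x / x\<^sup>2)) (at x)"
      using x t
      by (auto intro!: derivative_eq_intros gauss_tail_derivative std_normal_density_derivative
          simp: field_simps power2_eq_square)
    moreover have "- (std_normal_density x / x\<^sup>2) < 0"
      using x t by (simp add: normal_density_pos)
    ultimately show "\<exists>y. ((\<lambda>t. - ?D t) has_real_derivative y) (at x) \<and> y < 0" by blast
  next
    have "((\<lambda>t. std_normal_density t / t) \<longlongrightarrow> 0) at_top"
      unfolding std_normal_density_def by real_asymp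
    from tendsto_minus[OF tendsto_diff[OF gauss_tail_at_top this]]
    show "((\<lambda>t. - ?D t) \<longlongrightarrow> 0) at_top" by simp
  qed
  thus ?thesis using t by (simp add: field_simps)
qed simp

text \<open>The lower Mills bound says exactly that
  \<open>gauss_tail t * exp (t\<^sup>2 / 2 + 2 * t)\<close> is nondecreasing on
  \<open>t \<ge> - 1\<close>. The term \<open>2 * (a - b)\<close> is the price of
  \<open>t + 2\<close>; it vanishes in the application as \<rho> tends to 0.\<close>

lemma gauss_tail_ratio_le:
  assumes "- 1 \<le> b" "b \<le> a"
  shows "gauss_tail b \<le> gauss_tail a * exp ((a\<^sup>2 - b\<^sup>2) / 2 + 2 * (a - b))"
proof -
  let ?f = "\<lambda>t. gauss_tail t * exp (t\<^sup>2 / 2 + 2 * t)"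
  have "?f b \<le> ?f a"
  proof (rule DERIV_nonneg_imp_nondecreasing[OF assms(2)])
    fix x assume x: "b \<le> x" "x \<le> a"
    have "(?f has_real_derivative exp (x\<^sup>2 / 2 + 2 * x) *
        ((x + 2) * gauss_tail x - std_normal_density x)) (at x)"
      by (auto intro!: derivative_eq_intros gauss_tail_derivative simp: algebra_simps)
    moreover have "0 \<le> exp (x\<^sup>2 / 2 + 2 * x) * ((x + 2) * gauss_tail x - std_normal_density x)"
      using gauss_tail_ge[of x] x assms by (intro mult_nonneg_nonneg) auto
    ultimately show "\<exists>y. (?f has_real_derivative y) (at x) \<and> 0 \<le> y" by blast
  qed
  hence "gauss_tail b \<le> gauss_tail a * (exp (a\<^sup>2 / 2 + 2 * a) / exp (b\<^sup>2 / 2 + 2 * b))"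
    by (simp add: field_simps)
  also have "exp (a\<^sup>2 / 2 + 2 * a) / exp (b\<^sup>2 / 2 + 2 * b)
      = exp ((a\<^sup>2 - b\<^sup>2) / 2 + 2 * (a - b))"
    by (simp add: exp_diff[symmetric] diff_divide_distrib algebra_simps)
  finally show ?thesis .
qed

text \<open>The upper Mills bound makes \<open>gauss_tail t * exp (t\<^sup>2 / 2)\<close>
  nonincreasing on \<open>t \<ge> 0\<close>, so this direction has no error term.\<close>

lemma gauss_tail_ratio_ge:
  assumes "0 \<le> b" "b \<le> a"
  shows "gauss_tail a * exp ((a\<^sup>2 - b\<^sup>2) / 2) \<le> gauss_tail b"
proof -
  let ?f = "\<lambda>t. gauss_tail t * exp (t\<^sup>2 / 2)"
  have "?f a \<le> ?f b"
  proof (rule DERIV_nonpos_imp_nonincreasing[OF assms(2)])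
    fix x assume x: "b \<le> x" "x \<le> a"
    have "(?f has_real_derivative exp (x\<^sup>2 / 2) * (x * gauss_tail x - std_normal_density x)) (at x)"
      by (auto intro!: derivative_eq_intros gauss_tail_derivative simp: algebra_simps)
    moreover have "exp (x\<^sup>2 / 2) * (x * gauss_tail x - std_normal_density x) \<le> 0"
      using gauss_tail_le[of x] x assms by (intro mult_nonneg_nonpos) auto
    ultimately show "\<exists>y. (?f has_real_derivative y) (at x) \<and> y \<le> 0" by blast
  qed
  hence "gauss_tail a * exp (a\<^sup>2 / 2) / exp (b\<^sup>2 / 2) \<le> gauss_tail b"
    by (simp add: field_simps)
  thus ?thesis by (simp add: exp_diff diff_divide_distrib)
qed

text \<open>The mean value theorem on an interval of length 1 gives a bound on the whole line
  without a rational factor, so that the reciprocal is a pure Gaussian exponential.\<close>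

lemma gauss_tail_lower_bound: "std_normal_density (\<bar>w\<bar> + 1) \<le> gauss_tail w"
proof -
  have "\<exists>z>\<bar>w\<bar>. z < \<bar>w\<bar> + 1 \<and> gauss_tail (\<bar>w\<bar> + 1) - gauss_tail \<bar>w\<bar>
      = (\<bar>w\<bar> + 1 - \<bar>w\<bar>) * - std_normal_density z"
    by (rule MVT2) (auto intro: gauss_tail_derivative)
  then obtain z where z: "z > \<bar>w\<bar>" "z < \<bar>w\<bar> + 1"
    "gauss_tail (\<bar>w\<bar> + 1) - gauss_tail \<bar>w\<bar> = - std_normal_density z"
    by auto
  have "z\<^sup>2 \<le> (\<bar>w\<bar> + 1)\<^sup>2" using z by (intro power_mono) auto
  hence "std_normal_density (\<bar>w\<bar> + 1) \<le> std_normal_density z"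
    by (simp add: std_normal_density_def divide_right_mono)
  also have "\<dots> \<le> gauss_tail \<bar>w\<bar>" using z gauss_tail_pos[of "\<bar>w\<bar> + 1"] by linarith
  also have "\<dots> \<le> gauss_tail w" by (simp add: gauss_tail_le_iff)
  finally show ?thesis .
qed

text \<open>The reciprocal tail grows like \<open>exp (r\<^sup>2 * z\<^sup>2 / 2)\<close> up to
  lower order terms in the exponent, and \<open>r < 1\<close> leaves Gaussian decay.\<close>

lemma integrable_inverse_gauss_tail:
  assumes "0 \<le> r" "r < 1"
  shows "integrable lborel (\<lambda>z. std_normal_density z * (1 / gauss_tail (r * z + d)))"
proof -
  define D where "D = \<bar>d\<bar> + 1"
  \<comment> \<open>Half of the gap between 1 and the square of \<open>r\<close> absorbs the linear
    cross term, the other half remains as decay. The variance \<open>1 / c\<close> turns that decay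
    into a normal density.\<close>
  define c where "c = (1 - r\<^sup>2) / 2"
  define \<sigma> where "\<sigma> = 1 / sqrt c"
  define E where "E = r\<^sup>2 * D\<^sup>2 / c + D\<^sup>2"
  have r2: "r\<^sup>2 < 1" using assms by (simp add: power_less_one_iff abs_square_less_1)
  hence c: "0 < c" by (simp add: c_def)
  hence \<sigma>: "0 < \<sigma>" by (simp add: \<sigma>_def)
  have bound: "std_normal_density z * (1 / gauss_tail (r * z + d))
      \<le> exp (E / 2) * sqrt (2 * pi * \<sigma>\<^sup>2) * normal_density 0 \<sigma> z" for z
  proof -
    define w where "w = \<bar>r * z + d\<bar> + 1"
    have "w \<le> r * \<bar>z\<bar> + D" using assms abs_triangle_ineq[of "r * z" d]
      by (simp add: w_def D_def abs_mult)
    hence "w\<^sup>2 \<le> (r * \<bar>z\<bar> + D)\<^sup>2" by (intro power_mono) (auto simp: w_def)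
    also have "\<dots> \<le> (r\<^sup>2 + c) * z\<^sup>2 + E"
    proof -
      \<comment> \<open>Expanding this square bounds the cross term
        \<open>2 * r * \<bar>z\<bar> * D\<close>.\<close>
      have "0 \<le> (c * \<bar>z\<bar> - r * D)\<^sup>2 / c" using c by simp
      also have "\<dots> = c * z\<^sup>2 - 2 * r * \<bar>z\<bar> * D + r\<^sup>2 * D\<^sup>2 / c"
        using c by (simp add: power2_diff power_mult_distrib field_simps power2_eq_square)
      finally show ?thesis by (simp add: E_def power2_sum power_mult_distrib algebra_simps)
    qed
    also have "r\<^sup>2 + c = 1 - c" by (simp add: c_def field_simps)
    finally have w: "w\<^sup>2 \<le> (1 - c) * z\<^sup>2 + E" .
    have "std_normal_density z * (1 / gauss_tail (r * z + d))
        \<le> std_normal_density z * (1 / std_normal_density w)"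
      using gauss_tail_lower_bound[of "r * z + d"]
      by (intro mult_left_mono divide_left_mono mult_pos_pos gauss_tail_pos normal_density_pos)
        (auto simp: w_def)
    also have "\<dots> = exp (w\<^sup>2 / 2 - z\<^sup>2 / 2)"
      by (simp add: std_normal_density_def flip: exp_diff)
    also have "\<dots> \<le> exp (E / 2 + - (c * z\<^sup>2) / 2)"
      using w by (simp add: algebra_simps)
    also have "\<dots> = exp (E / 2) * exp (- (z\<^sup>2 / (2 * \<sigma>\<^sup>2)))"
      unfolding exp_add using c by (simp add: \<sigma>_def power_divide)
    also have "\<dots> = exp (E / 2) * sqrt (2 * pi * \<sigma>\<^sup>2) * normal_density 0 \<sigma> z"
      using \<sigma> by (simp add: normal_density_def)
    finally show ?thesis .
  qed
  have "integrable lborel (\<lambda>z. exp (E / 2) * sqrt (2 * pi * \<sigma>\<^sup>2) * normal_density 0 \<sigma> z)"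
    using \<sigma> by (intro integrable_mult_right) auto
  thus ?thesis
  proof (rule Bochner_Integration.integrable_bound)
    show "AE z in lborel. norm (std_normal_density z * (1 / gauss_tail (r * z + d)))
        \<le> norm (exp (E / 2) * sqrt (2 * pi * \<sigma>\<^sup>2) * normal_density 0 \<sigma> z)"
    proof (rule AE_I2)
      fix z
      have "0 \<le> std_normal_density z * (1 / gauss_tail (r * z + d))"
        using gauss_tail_pos[of "r * z + d"] by simp
      with bound[of z] show "norm (std_normal_density z * (1 / gauss_tail (r * z + d)))
        \<le> norm (exp (E / 2) * sqrt (2 * pi * \<sigma>\<^sup>2) * normal_density 0 \<sigma> z)" by simp
    qed
  qed simp
qed

text \<open>The summand of the bound in \<open>FDP_le_sum\<close>, as a function of a single
  p-value.\<close>

definition trunc_inverse :: "real \<Rightarrow> real \<Rightarrow> real" where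
  "trunc_inverse \<epsilon> q = (if q \<le> \<epsilon> then 1 / q else 0)"

lemma trunc_inverse_measurable [measurable]: "trunc_inverse \<epsilon> \<in> borel_measurable borel"
  unfolding trunc_inverse_def[abs_def] by measurable

text \<open>Dominated convergence along \<epsilon> = 1 / (k + 1): at each \<open>z\<close> the tail
  is positive, so the truncated integrand is eventually 0.\<close>

lemma integral_trunc_inverse_small:
  assumes "0 \<le> r" "r < 1" "0 < \<delta>" "0 < B"
  obtains \<epsilon> where "0 < \<epsilon>" "\<epsilon> < B"
    "(\<integral>z. std_normal_density z * trunc_inverse \<epsilon> (gauss_tail (r * z + d)) \<partial>lborel) < \<delta>"
proof -
  have "(\<lambda>k. \<integral>z. std_normal_density z *
      trunc_inverse (1 / real (Suc k)) (gauss_tail (r * z + d)) \<partial>lborel)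
      \<longlonglongrightarrow> (\<integral>z. 0 \<partial>(lborel :: real measure))"
  proof (rule integral_dominated_convergence[OF _ _ integrable_inverse_gauss_tail[OF assms(1,2)]])
    show "AE z in lborel. (\<lambda>k. std_normal_density z *
        trunc_inverse (1 / real (Suc k)) (gauss_tail (r * z + d))) \<longlonglongrightarrow> 0"
    proof (rule AE_I2)
      fix z
      have "eventually (\<lambda>k. 1 / real (Suc k) < gauss_tail (r * z + d)) sequentially"
        using LIMSEQ_inverse_real_of_nat gauss_tail_pos
        by (intro order_tendstoD(2)) (auto simp: inverse_eq_divide)
      hence "eventually (\<lambda>k. std_normal_density z *
        trunc_inverse (1 / real (Suc k)) (gauss_tail (r * z + d)) = 0) sequentially"
        by eventually_elim (simp add: trunc_inverse_def)
      thus "(\<lambda>k. std_normal_density z *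
        trunc_inverse (1 / real (Suc k)) (gauss_tail (r * z + d))) \<longlonglongrightarrow> 0"
        by (rule tendsto_eventually)
    qed
    show "AE z in lborel. norm (std_normal_density z *
        trunc_inverse (1 / real (Suc k)) (gauss_tail (r * z + d)))
        \<le> std_normal_density z * (1 / gauss_tail (r * z + d))" for k
      using gauss_tail_pos by (intro AE_I2) (auto simp: trunc_inverse_def abs_mult less_imp_le)
  qed auto
  hence "(\<lambda>k. \<integral>z. std_normal_density z *
      trunc_inverse (1 / real (Suc k)) (gauss_tail (r * z + d)) \<partial>lborel) \<longlonglongrightarrow> 0"
    by simp
  from order_tendstoD(2)[OF this assms(3)] order_tendstoD(2)[OF LIMSEQ_inverse_real_of_nat assms(4)]
  have "eventually (\<lambda>k. (\<integral>z. std_normal_density z *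
      trunc_inverse (1 / real (Suc k)) (gauss_tail (r * z + d)) \<partial>lborel) < \<delta> \<and>
      1 / real (Suc k) < B) sequentially"
    by eventually_elim (simp add: inverse_eq_divide)
  then obtain k where "(\<integral>z. std_normal_density z *
      trunc_inverse (1 / real (Suc k)) (gauss_tail (r * z + d)) \<partial>lborel) < \<delta>" "1 / real (Suc k) < B"
    by (auto simp: eventually_sequentially)
  thus ?thesis by (intro that[of "1 / real (Suc k)"]) auto
qed

section \<open>The critical value of the common factor\<close>

text \<open>
  Given \<open>X\<^sub>0 = x\<close>, a true p-value lies below \<open>gauss_tail a\<close> with probability
  \<open>gauss_tail ((a + sqrt \<rho> * x) / sqrt (1 - \<rho>))\<close>. So \<open>x\<close> is supercritical iff this conditional
  c.d.f. exceeds the rejection line \<open>t / \<alpha>\<close> somewhere.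
\<close>
definition supercritical :: "real \<Rightarrow> real \<Rightarrow> real set" where
  "supercritical \<alpha> \<rho> =
     {x. \<exists>a. gauss_tail a < \<alpha> * gauss_tail ((a + sqrt \<rho> * x) / sqrt (1 - \<rho>))}"

definition critical_point :: "real \<Rightarrow> real \<Rightarrow> real" where
  "critical_point \<alpha> \<rho> = Sup (supercritical \<alpha> \<rho>)"

text \<open>Lowering \<open>x\<close> increases the right-hand side, so the same witness
  \<open>a\<close> serves.\<close>

lemma supercritical_downward:
  assumes "0 < \<alpha>" "0 < \<rho>" "\<rho> < 1" "x \<in> supercritical \<alpha> \<rho>" "x' \<le> x"
  shows "x' \<in> supercritical \<alpha> \<rho>"
proof -
  obtain a where a: "gauss_tail a < \<alpha> * gauss_tail ((a + sqrt \<rho> * x) / sqrt (1 - \<rho>))"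
    using assms(4) by (auto simp: supercritical_def)
  also have "\<dots> \<le> \<alpha> * gauss_tail ((a + sqrt \<rho> * x') / sqrt (1 - \<rho>))"
    using assms by (intro mult_left_mono) (auto simp: gauss_tail_le_iff intro!: divide_right_mono)
  finally show ?thesis by (auto simp: supercritical_def)
qed

text \<open>At the witness \<open>a = y / sqrt \<rho>\<close> the exponent
  \<open>a\<^sup>2 - b\<^sup>2\<close> equals \<open>y\<^sup>2\<close> exactly, so the tail ratio
  exceeds 1 / \<alpha> for every \<rho> in (0,1), not only in the limit.\<close>

lemma uminus_in_supercritical:
  assumes "0 < \<alpha>" "\<alpha> < 1" "0 < \<rho>" "\<rho> < 1" "sqrt (- 2 * ln \<alpha>) < y"
  shows "- y \<in> supercritical \<alpha> \<rho>"
proof -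
  define a where "a = y / sqrt \<rho>"
  define b where "b = (a + sqrt \<rho> * (- y)) / sqrt (1 - \<rho>)"
  have L: "0 \<le> - 2 * ln \<alpha>" using assms by simp
  have y: "0 < y" using assms L by (smt (verit) real_sqrt_ge_0_iff)
  have "(sqrt (- 2 * ln \<alpha>))\<^sup>2 < y\<^sup>2"
    by (rule power_strict_mono) (use assms L in auto)
  hence y2: "- 2 * ln \<alpha> < y\<^sup>2" using L by simp
  have b: "b = sqrt (1 - \<rho>) * a"
  proof -
    have "a + sqrt \<rho> * (- y) = a * (1 - \<rho>)"
      using assms by (simp add: a_def field_simps power2_eq_square[symmetric] flip: real_sqrt_pow2)
    thus ?thesis
      using assms real_div_sqrt[of "1 - \<rho>"]
      by (simp only: b_def) (simp add: mult.commute flip: times_divide_eq_right)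
  qed
  have a0: "0 < a" using y assms by (simp add: a_def)
  have "b \<le> 1 * a" unfolding b using assms a0 by (intro mult_right_mono) auto
  moreover have "0 \<le> b" unfolding b using assms a0 by simp
  ultimately have "gauss_tail a * exp ((a\<^sup>2 - b\<^sup>2) / 2) \<le> gauss_tail b"
    by (intro gauss_tail_ratio_ge) auto
  moreover have "a\<^sup>2 - b\<^sup>2 = y\<^sup>2"
    using assms by (simp add: b a_def power_divide power_mult_distrib field_simps)
  moreover have "exp (- ln \<alpha>) < exp (y\<^sup>2 / 2)" using y2 by simp
  moreover have "exp (- ln \<alpha>) = 1 / \<alpha>" using assms by (simp add: exp_minus field_simps)
  ultimately have "gauss_tail a * (1 / \<alpha>) < gauss_tail b"
    using gauss_tail_pos[of a] by (smt (verit) mult_strict_left_mono)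
  hence "gauss_tail a < \<alpha> * gauss_tail b" using assms by (simp add: field_simps)
  thus ?thesis by (auto simp: supercritical_def b_def)
qed

text \<open>
  Completing the square shows that the exponent \<open>(a\<^sup>2 - b\<^sup>2) / 2\<close> of the tail ratio is at most
  \<open>y\<^sup>2 / 2\<close> for every \<open>a\<close>; the point \<open>a = y / sqrt \<rho>\<close> used above is where it is attained.
\<close>
lemma uminus_notin_supercritical:
  assumes "0 < \<alpha>" "\<alpha> \<le> 1/2" "0 < \<rho>" "\<rho> < 1" "0 \<le> y"
    and "sqrt \<rho> * y / sqrt (1 - \<rho>) \<le> 1"
    and "y\<^sup>2 / 2 + 2 * (sqrt \<rho> * y / sqrt (1 - \<rho>)) \<le> - ln \<alpha>"
  shows "- y \<notin> supercritical \<alpha> \<rho>"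
proof
  assume "- y \<in> supercritical \<alpha> \<rho>"
  then obtain a where a: "gauss_tail a < \<alpha> * gauss_tail ((a + sqrt \<rho> * (- y)) / sqrt (1 - \<rho>))"
    by (auto simp: supercritical_def)
  define s where "s = sqrt \<rho>"
  define r where "r = sqrt (1 - \<rho>)"
  define b where "b = (a - s * y) / r"
  have r: "0 < r" "r \<le> 1" "r\<^sup>2 = 1 - \<rho>" and s: "0 < s" "s\<^sup>2 = \<rho>"
    using assms by (auto simp: r_def s_def)
  have ab: "gauss_tail a < \<alpha> * gauss_tail b"
    using a by (simp add: b_def s_def r_def)
  \<comment> \<open>Here \<alpha> \<le> 1/2 enters: for \<open>a \<le> 0\<close> the left side of
    \<open>ab\<close> is at least 1/2 and the right side at most \<alpha>.\<close>
  have "0 < a"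
  proof (rule ccontr)
    assume "\<not> 0 < a"
    hence "1 / 2 \<le> gauss_tail a" using gauss_tail_le_iff[of 0 a] by (simp add: gauss_tail_def Phi_0)
    also have "\<dots> < \<alpha> * gauss_tail b" by (rule ab)
    also have "\<dots> \<le> 1/2 * 1"
      using assms gauss_tail_less_1[of b] gauss_tail_pos[of b] by (intro mult_mono) auto
    finally show False by simp
  qed
  have ar: "a \<le> a / r" using \<open>0 < a\<close> r by (simp add: field_simps mult_left_le)
  have bge: "a - b \<le> s * y / r" using ar by (simp add: b_def diff_divide_distrib)
  have b1: "- 1 \<le> b" using ar \<open>0 < a\<close> assms(6) unfolding b_def diff_divide_distrib s_def r_def by linarith
  have ba: "b < a"
  proof (rule ccontr)
    assume "\<not> b < a"
    hence "gauss_tail b \<le> gauss_tail a" by (simp add: gauss_tail_le_iff)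
    moreover have "\<alpha> * gauss_tail b \<le> 1 * gauss_tail b"
      using assms gauss_tail_pos[of b] by (intro mult_right_mono) auto
    ultimately show False using ab by linarith
  qed
  have sq: "a\<^sup>2 - b\<^sup>2 \<le> y\<^sup>2"
  proof -
    have "b\<^sup>2 * r\<^sup>2 = (a - s * y)\<^sup>2" using r(1) by (simp add: b_def power_divide)
    \<comment> \<open>This is the completed square; it vanishes at \<open>a = y / s\<close>.\<close>
    hence "(y\<^sup>2 - (a\<^sup>2 - b\<^sup>2)) * (1 - s\<^sup>2) = (s * a - y)\<^sup>2"
      unfolding r(3) s(2)[symmetric] by (simp add: algebra_simps power2_eq_square)
    hence "0 \<le> (y\<^sup>2 - (a\<^sup>2 - b\<^sup>2)) * (1 - s\<^sup>2)" by simp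
    moreover have "0 < 1 - s\<^sup>2" using assms s by simp
    ultimately have "0 \<le> y\<^sup>2 - (a\<^sup>2 - b\<^sup>2)" by (simp add: zero_le_mult_iff)
    thus ?thesis by simp
  qed
  have "gauss_tail b \<le> gauss_tail a * exp ((a\<^sup>2 - b\<^sup>2) / 2 + 2 * (a - b))"
    using b1 ba by (intro gauss_tail_ratio_le) auto
  also have "(a\<^sup>2 - b\<^sup>2) / 2 + 2 * (a - b) \<le> - ln \<alpha>"
  proof -
    define d where "d = s * y / r"
    have "a - b \<le> d" "y\<^sup>2 / 2 + 2 * d \<le> - ln \<alpha>"
      using bge assms(7) by (simp_all only: d_def s_def r_def)
    thus ?thesis using sq by argo
  qed
  hence "gauss_tail a * exp ((a\<^sup>2 - b\<^sup>2) / 2 + 2 * (a - b)) \<le> gauss_tail a * exp (- ln \<alpha>)"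
    using gauss_tail_pos[of a] by (intro mult_left_mono) auto
  also have "exp (- ln \<alpha>) = 1 / \<alpha>" using assms by (simp add: exp_minus field_simps)
  finally have "\<alpha> * gauss_tail b \<le> gauss_tail a" using assms by (simp add: field_simps)
  with ab show False by linarith
qed

text \<open>The supremum is meaningful because the set is a nonempty down-set that does not contain
  0. Membership of the critical point itself stays undecided.\<close>

lemma
  assumes "0 < \<alpha>" "\<alpha> \<le> 1/2" "0 < \<rho>" "\<rho> < 1"
  shows supercritical_less: "x < critical_point \<alpha> \<rho> \<Longrightarrow> x \<in> supercritical \<alpha> \<rho>"
    and supercritical_gr: "critical_point \<alpha> \<rho> < x \<Longrightarrow> x \<notin> supercritical \<alpha> \<rho>"
    and critical_point_le: "z \<notin> supercritical \<alpha> \<rho> \<Longrightarrow> critical_point \<alpha> \<rho> \<le> z"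
    and critical_point_ge: "- sqrt (- 2 * ln \<alpha>) \<le> critical_point \<alpha> \<rho>"
proof -
  have ne: "supercritical \<alpha> \<rho> \<noteq> {}"
    using uminus_in_supercritical[of \<alpha> \<rho> "sqrt (- 2 * ln \<alpha>) + 1"] assms by auto
  have "- 0 \<notin> supercritical \<alpha> \<rho>"
    using assms by (intro uminus_notin_supercritical) auto
  hence "x \<le> 0" if "x \<in> supercritical \<alpha> \<rho>" for x
    using that supercritical_downward[of \<alpha> \<rho> x 0] assms by force
  hence bdd: "bdd_above (supercritical \<alpha> \<rho>)" by (auto simp: bdd_above_def)
  show "x \<in> supercritical \<alpha> \<rho>" if "x < critical_point \<alpha> \<rho>"
    using that less_cSup_iff[OF ne bdd, of x] supercritical_downward[of \<alpha> \<rho> _ x] assms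
    by (auto simp: critical_point_def)
  show "x \<notin> supercritical \<alpha> \<rho>" if "critical_point \<alpha> \<rho> < x"
    using that cSup_upper[OF _ bdd, of x] by (auto simp: critical_point_def)
  show "critical_point \<alpha> \<rho> \<le> z" if "z \<notin> supercritical \<alpha> \<rho>"
    unfolding critical_point_def using that supercritical_downward[of \<alpha> \<rho> _ z] assms
    by (intro cSup_least[OF ne]) force
  show "- sqrt (- 2 * ln \<alpha>) \<le> critical_point \<alpha> \<rho>"
  \<comment> \<open>Only points strictly below the bound are known to be supercritical, so the bound
    is approached from below.\<close>
  proof (rule dense_le)
    fix x assume "x < - sqrt (- 2 * ln \<alpha>)"
    hence "- (- x) \<in> supercritical \<alpha> \<rho>"
      using assms by (intro uminus_in_supercritical) auto
    thus "x \<le> critical_point \<alpha> \<rho>"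
      using cSup_upper[OF _ bdd, of x] by (simp add: critical_point_def)
  qed
qed

text \<open>The lower bound holds for each \<rho>. For the upper bound a fixed \<open>- y\<close>
  slightly above the limit leaves the supercritical set once the error term of order
  \<open>sqrt \<rho>\<close> is small.\<close>

lemma critical_point_tendsto:
  assumes "0 < \<alpha>" "\<alpha> \<le> 1/2"
  shows "(critical_point \<alpha> \<longlongrightarrow> - sqrt (- 2 * ln \<alpha>)) (at_right 0)"
proof (rule order_tendstoI)
  have ev: "eventually (\<lambda>\<rho>. 0 < \<rho> \<and> \<rho> < (1::real)) (at_right 0)"
    using eventually_at_right_real[of 0 "1::real"] by simp
  fix l assume l: "l < - sqrt (- 2 * ln \<alpha>)"
  from ev show "eventually (\<lambda>\<rho>. l < critical_point \<alpha> \<rho>) (at_right 0)"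
    by eventually_elim (use l critical_point_ge[of \<alpha>] assms in force)
next
  have ev: "eventually (\<lambda>\<rho>. 0 < \<rho> \<and> \<rho> < (1::real)) (at_right 0)"
    using eventually_at_right_real[of 0 "1::real"] by simp
  fix u assume u: "- sqrt (- 2 * ln \<alpha>) < u"
  have c: "0 < sqrt (- 2 * ln \<alpha>)" using assms by simp
  \<comment> \<open>Being strictly below the root leaves room for the error term, and
    \<open>- u < y\<close> puts \<open>- y\<close> below \<open>u\<close>.\<close>
  obtain y where y: "max 0 (- u) < y" "y < sqrt (- 2 * ln \<alpha>)"
    using dense[of "max 0 (- u)" "sqrt (- 2 * ln \<alpha>)"] u c by auto
  have "y\<^sup>2 < (sqrt (- 2 * ln \<alpha>))\<^sup>2" by (rule power_strict_mono) (use y in auto)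
  hence y2: "y\<^sup>2 / 2 < - ln \<alpha>" using assms by simp
  have lim: "((\<lambda>\<rho>. sqrt \<rho> * y / sqrt (1 - \<rho>)) \<longlongrightarrow> sqrt 0 * y / sqrt (1 - 0)) (at_right 0)"
    by (intro tendsto_intros) auto
  have "((\<lambda>\<rho>. y\<^sup>2 / 2 + 2 * (sqrt \<rho> * y / sqrt (1 - \<rho>))) \<longlongrightarrow>
      y\<^sup>2 / 2 + 2 * (sqrt 0 * y / sqrt (1 - 0))) (at_right 0)"
    by (intro tendsto_add tendsto_mult lim tendsto_const)
  hence "eventually (\<lambda>\<rho>. y\<^sup>2 / 2 + 2 * (sqrt \<rho> * y / sqrt (1 - \<rho>)) < - ln \<alpha>) (at_right 0)"
    by (rule order_tendstoD(2)) (use y2 in simp)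
  moreover have "eventually (\<lambda>\<rho>. sqrt \<rho> * y / sqrt (1 - \<rho>) < 1) (at_right 0)"
    using lim by (rule order_tendstoD(2)) simp
  ultimately have "eventually (\<lambda>\<rho>. critical_point \<alpha> \<rho> \<le> - y) (at_right 0)"
    using ev
  proof eventually_elim
    case (elim \<rho>)
    thus ?case
      using assms y by (intro critical_point_le uminus_notin_supercritical) auto
  qed
  thus "eventually (\<lambda>\<rho>. critical_point \<alpha> \<rho> < u) (at_right 0)"
    by eventually_elim (use y in auto)
qed

section \<open>The linear step-up procedure\<close>

text \<open>In a sorted list the entries up to \<open>c\<close> form an initial segment.\<close>

lemma nth_sorted_le_iff:
  fixes c :: "'a :: linorder"
  assumes "sorted ys" "k < length ys"
  shows "ys ! k \<le> c \<longleftrightarrow> k < length (filter (\<lambda>x. x \<le> c) ys)"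
  using assms
proof (induction ys arbitrary: k)
  case (Cons y ys)
  show ?case
  proof (cases "y \<le> c")
    case True
    thus ?thesis using Cons by (cases k) auto
  next
    case False
    hence "filter (\<lambda>x. x \<le> c) (y # ys) = []"
      using Cons.prems by (auto simp: filter_empty_conv)
    moreover have "\<not> (y # ys) ! k \<le> c"
      using False Cons.prems by (cases k) (auto dest!: bspec[OF _ nth_mem])
    ultimately show ?thesis by simp
  qed
qed simp

text \<open>Sorting preserves the number of entries up to \<open>c\<close>, so order statistics can
  be traded for counts. Ordered p-values are numbered from 1 but list positions from 0, hence
  \<open>j - 1\<close> in the proof.\<close>

lemma ordered_p_le_iff:
  assumes "1 \<le> j" "j \<le> n"
  shows "ordered_p n p j \<le> c \<longleftrightarrow> j \<le> card {i\<in>{1..n}. p i \<le> c}"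
proof -
  have "length (filter (\<lambda>x. x \<le> c) (sort (map p [1..<n+1])))
      = length (filter (\<lambda>x. x \<le> c) (map p [1..<n+1]))"
    by (metis mset_filter mset_sort size_mset)
  also have "\<dots> = length (filter (\<lambda>i. p i \<le> c) [1..<n+1])"
    by (simp add: filter_map o_def)
  also have "\<dots> = card {i\<in>{1..n}. p i \<le> c}"
    by (subst distinct_card[symmetric]) (auto intro!: arg_cong[where f = card])
  finally show ?thesis
    using assms nth_sorted_le_iff[of "sort (map p [1..<n+1])" "j - 1" c]
    by (auto simp: ordered_p_def)
qed

lemma su_index_in:
  "su_index \<alpha> n p \<in> {j\<in>{1..n}. ordered_p n p j \<le> real j * \<alpha> / real n} \<union> {0}"
  unfolding su_index_def by (rule Max_in) auto

lemma su_index_le: "su_index \<alpha> n p \<le> n"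
  using su_index_in[of \<alpha> n p] by auto

lemma su_index_ge:
  assumes "1 \<le> j" "j \<le> n" "j \<le> card {i\<in>{1..n}. p i \<le> real j * \<alpha> / real n}"
  shows "j \<le> su_index \<alpha> n p"
  unfolding su_index_def using assms by (intro Max_ge) (auto simp: ordered_p_le_iff)

text \<open>At least \<open>m\<close> p-values lie below the threshold. If there were more, their
  number would itself be an admissible index, against the maximality of \<open>m\<close>.\<close>

lemma card_su_rejected:
  assumes "0 < \<alpha>"
  shows "card (su_rejected \<alpha> n p) = su_index \<alpha> n p"
proof (cases "su_index \<alpha> n p = 0")
  case False
  define m where "m = su_index \<alpha> n p"
  define R where "R = {i\<in>{1..n}. p i \<le> real m * \<alpha> / real n}"
  have m: "1 \<le> m" "m \<le> n" "m \<le> card R"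
    using su_index_in[of \<alpha> n p] False by (auto simp: m_def[symmetric] R_def ordered_p_le_iff)
  have "card R \<le> card {1..n}" unfolding R_def by (intro card_mono) auto
  hence Rn: "card R \<le> n" by simp
  have "card R \<le> card {i\<in>{1..n}. p i \<le> real (card R) * \<alpha> / real n}"
  proof (rule card_mono)
    have "real m * \<alpha> / real n \<le> real (card R) * \<alpha> / real n"
      using m assms by (intro divide_right_mono mult_right_mono) auto
    thus "R \<subseteq> {i\<in>{1..n}. p i \<le> real (card R) * \<alpha> / real n}" by (auto simp: R_def)
  qed simp
  hence "card R \<le> m"
    unfolding m_def using m Rn by (intro su_index_ge) auto
  with m show ?thesis using False by (simp add: su_rejected_def Let_def m_def[symmetric] R_def)
qed (simp add: su_rejected_def)

section \<open>Pathwise bounds for the false discovery proportion\<close>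

definition FDP :: "real \<Rightarrow> nat \<Rightarrow> nat set \<Rightarrow> (nat \<Rightarrow> real) \<Rightarrow> real" where
  "FDP \<alpha> n T p = (let R = su_rejected \<alpha> n p in real (card (R \<inter> T)) / real (max (card R) 1))"

lemma finite_su_rejected [simp]: "finite (su_rejected \<alpha> n p)"
  by (simp add: su_rejected_def Let_def)

lemma FDP_nonneg: "0 \<le> FDP \<alpha> n T p"
  by (simp add: FDP_def Let_def)

lemma FDP_le_1: "FDP \<alpha> n T p \<le> 1"
proof -
  have "card (su_rejected \<alpha> n p \<inter> T) \<le> card (su_rejected \<alpha> n p)" by (intro card_mono) auto
  thus ?thesis by (auto simp: FDP_def Let_def divide_simps)
qed

text \<open>Once the empirical c.d.f. reaches the line \<open>t / \<alpha>\<close>, at least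
  \<open>n * t / \<alpha>\<close> hypotheses are rejected, and at most \<open>n - card T\<close> of
  these are false hypotheses.\<close>

lemma FDP_ge:
  assumes "0 < \<alpha>" "0 < n" "0 < t" "T \<subseteq> {1..n}"
    and "real n * t / \<alpha> \<le> real (card {i\<in>{1..n}. p i \<le> t})"
  shows "1 - real (n - card T) * \<alpha> / (real n * t) \<le> FDP \<alpha> n T p"
proof -
  define C where "C = card {i\<in>{1..n}. p i \<le> t}"
  define R where "R = su_rejected \<alpha> n p"
  have C: "real n * t / \<alpha> \<le> real C" using assms by (simp add: C_def)
  have "0 < real n * t / \<alpha>" using assms by simp
  with C have C0: "0 < C" by (cases C) auto
  have "C \<le> card {1..n}" unfolding C_def by (intro card_mono) auto
  moreover have "C \<le> card {i\<in>{1..n}. p i \<le> real C * \<alpha> / real n}"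
  proof -
    have "t \<le> real C * \<alpha> / real n" using C assms by (simp add: field_simps)
    thus ?thesis unfolding C_def by (intro card_mono) auto
  qed
  ultimately have "C \<le> su_index \<alpha> n p" using C0 by (intro su_index_ge) auto
  hence R: "C \<le> card R" using assms by (simp add: R_def card_su_rejected)
  have "card (R - T) \<le> card ({1..n} - T)"
    by (intro card_mono) (auto simp: R_def su_rejected_def Let_def split: if_splits)
  also have "\<dots> = n - card T" using assms finite_subset by (subst card_Diff_subset) auto
  finally have k: "card (R - T) \<le> n - card T" .
  have "card R = card (R \<inter> T) + card (R - T)"
    by (subst card_Un_disjoint[symmetric]) (auto simp: R_def intro!: arg_cong[where f = card])
  hence "FDP \<alpha> n T p = 1 - real (card (R - T)) / real (card R)"
    using R C0 by (simp add: FDP_def Let_def R_def[symmetric] field_simps)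
  moreover have "real (card (R - T)) / real (card R) \<le> real (n - card T) / (real n * t / \<alpha>)"
    using k R C assms by (intro frac_le) auto
  ultimately show ?thesis by simp
qed

text \<open>
  With \<open>m\<close> rejections every rejected true hypothesis has \<open>q i \<le> p i \<le> m * \<alpha> / n\<close>, that is,
  \<open>1 / m \<le> \<alpha> / (n * q i)\<close>. This replaces a maximal inequality for the empirical process near zero.
\<close>
lemma FDP_le_sum:
  assumes "0 < \<alpha>" "T \<subseteq> {1..n}"
    and "\<And>i. i \<in> T \<Longrightarrow> q i \<le> p i" and q0: "\<And>i. 0 < q i"
    and "real (su_index \<alpha> n p) * \<alpha> / real n \<le> \<epsilon>"
  shows "FDP \<alpha> n T p \<le> \<alpha> / real n * (\<Sum>i=1..n. if q i \<le> \<epsilon> then 1 / q i else 0)"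
proof (cases "su_index \<alpha> n p = 0")
  case True
  hence "FDP \<alpha> n T p = 0" by (simp add: FDP_def su_rejected_def)
  also have "0 \<le> \<alpha> / real n * (\<Sum>i=1..n. if q i \<le> \<epsilon> then 1 / q i else 0)"
    using assms(1) q0 by (intro mult_nonneg_nonneg sum_nonneg) (auto intro: less_imp_le)
  finally show ?thesis .
next
  case False
  define m where "m = su_index \<alpha> n p"
  have m: "1 \<le> m" "m \<le> n" using False su_index_le[of \<alpha> n p] by (auto simp: m_def)
  define V where "V = su_rejected \<alpha> n p \<inter> T"
  have V: "V \<subseteq> {1..n}" "\<And>i. i \<in> V \<Longrightarrow> q i \<le> real m * \<alpha> / real n"
    using assms(2,3) False by (fastforce simp: V_def su_rejected_def Let_def m_def)+
  have "FDP \<alpha> n T p = real (card V) / real m"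
    using m by (simp add: FDP_def Let_def V_def card_su_rejected[OF assms(1)] m_def[symmetric])
  also have "\<dots> = (\<Sum>i\<in>V. 1 / real m)" by simp
  also have "\<dots> \<le> (\<Sum>i\<in>V. \<alpha> / real n * (if q i \<le> \<epsilon> then 1 / q i else 0))"
  proof (rule sum_mono)
    fix i assume "i \<in> V"
    hence "q i \<le> real m * \<alpha> / real n" "q i \<le> \<epsilon>" using V(2)[of i] assms(5) by (auto simp: m_def)
    thus "1 / real m \<le> \<alpha> / real n * (if q i \<le> \<epsilon> then 1 / q i else 0)"
      using m q0[of i] by (simp add: field_simps)
  qed
  also have "\<dots> \<le> (\<Sum>i=1..n. \<alpha> / real n * (if q i \<le> \<epsilon> then 1 / q i else 0))"
    using V(1) assms q0 by (intro sum_mono2) (auto intro!: mult_nonneg_nonneg less_imp_le)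
  finally show ?thesis by (simp add: sum_distrib_left)
qed

text \<open>A rejected index is either a false hypothesis or a true one with
  \<open>q i \<le> p i\<close> below the threshold. Thus a large \<open>su_index\<close> forces many
  small values among the \<open>q i\<close>.\<close>

lemma su_index_le_count:
  assumes "0 < \<alpha>" "T \<subseteq> {1..n}" "\<And>i. i \<in> T \<Longrightarrow> q i \<le> p i"
  shows "su_index \<alpha> n p \<le>
    (n - card T) + card {i\<in>{1..n}. q i \<le> real (su_index \<alpha> n p) * \<alpha> / real n}" (is "?m \<le> _ + card ?S")
proof (cases "?m = 0")
  case False
  have "?m = card (su_rejected \<alpha> n p)" using assms by (simp add: card_su_rejected)
  also have "\<dots> \<le> card (({1..n} - T) \<union> ?S)"
    using assms(2,3) False
    by (intro card_mono) (fastforce simp: su_rejected_def Let_def)+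
  also have "\<dots> \<le> card ({1..n} - T) + card ?S" by (rule card_Un_le)
  also have "card ({1..n} - T) = n - card T"
    using assms finite_subset by (subst card_Diff_subset) auto
  finally show ?thesis .
qed simp

section \<open>Measurability of the procedure\<close>

lemma su_index_measurable:
  assumes "\<And>i. (\<lambda>\<omega>. p \<omega> i) \<in> borel_measurable M"
  shows "(\<lambda>\<omega>. su_index \<alpha> n (p \<omega>)) \<in> measurable M (count_space UNIV)"
proof -
  note [measurable] = assms
  have eq: "su_index \<alpha> n p = Max (insert 0 {j. j \<in> {1..n} \<and>
      j \<le> card {i. i \<in> {1..n} \<and> p i \<le> real j * \<alpha> / real n}})" for p
    unfolding su_index_def by (rule arg_cong[where f = Max]) (auto simp: ordered_p_le_iff)
  \<comment> \<open>Counts replace sorting, and the default 0 becomes a disjunct, which leaves a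
    maximum over a fixed finite range.\<close>
  have "(\<lambda>\<omega>. Max (insert 0 {j. j \<in> {1..n} \<and>
      j \<le> card {i. i \<in> {1..n} \<and> p \<omega> i \<le> real j * \<alpha> / real n}})) = (\<lambda>\<omega>. Max {j\<in>{0..n}. j = 0 \<or>
      j \<le> card {i. i \<in> {1..n} \<and> p \<omega> i \<le> real j * \<alpha> / real n}})"
    by (intro ext arg_cong[where f = Max]) auto
  also have "\<dots> \<in> measurable M (count_space UNIV)"
    by measurable
  finally show ?thesis unfolding eq .
qed

lemma FDP_measurable:
  assumes "\<And>i. (\<lambda>\<omega>. p \<omega> i) \<in> borel_measurable M"
  shows "(\<lambda>\<omega>. FDP \<alpha> n T (p \<omega>)) \<in> borel_measurable M"
proof -
  note [measurable] = assms su_index_measurable[OF assms]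
  have [measurable]: "Measurable.pred M (\<lambda>\<omega>. i \<in> su_rejected \<alpha> n (p \<omega>))" for i
    unfolding su_rejected_def Let_def by simp
  show ?thesis unfolding FDP_def Let_def by measurable
qed

section \<open>Convergence of the false discovery rate\<close>

locale iid_std_normal = prob_space M for M :: "'a measure" +
  fixes X :: "nat \<Rightarrow> 'a \<Rightarrow> real"
  assumes indep: "indep_vars (\<lambda>_. borel) X UNIV"
    and normal: "\<And>i. distributed M lborel (X i) std_normal_density"
begin

lemma X_measurable [measurable]: "X i \<in> borel_measurable M"
  using distributed_measurable[OF normal[of i]] by simp

section \<open>Laws of single variables and concentration of exceedance counts\<close>

lemma prob_X:
  assumes "A \<in> sets borel"
  shows "prob {\<omega>\<in>space M. X i \<omega> \<in> A} = measure (density lborel std_normal_density) A"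
proof -
  have "measure (distr M lborel (X i)) A = prob (X i -` A \<inter> space M)"
    using assms by (intro measure_distr) auto
  thus ?thesis
    by (simp add: distributed_distr_eq_density[OF normal] vimage_def Int_def conj_commute)
qed

lemma prob_X_le: "prob {\<omega>\<in>space M. X i \<omega> \<le> x} = Phi x"
  using prob_X[of "{..x}" i] by (simp add: Phi_def cdf_def)

lemma prob_X_ge: "prob {\<omega>\<in>space M. b \<le> X i \<omega>} = gauss_tail b"
proof -
  interpret N: prob_space "density lborel std_normal_density"
    by (rule prob_space_normal_density) simp
  interpret N: real_distribution "density lborel std_normal_density"
    by unfold_locales auto
  have "measure (density lborel std_normal_density) {b} = 0"
    using N.isCont_cdf[of b] isCont_Phi[of b] by (simp add: Phi_def[abs_def])
  moreover have "measure (density lborel std_normal_density) {..b}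
      = measure (density lborel std_normal_density) {..<b}
        + measure (density lborel std_normal_density) {b}"
    by (subst N.finite_measure_Union[symmetric]) (auto intro!: arg_cong2[where f = measure])
  moreover have "measure (density lborel std_normal_density) {b..}
      = 1 - measure (density lborel std_normal_density) {..<b}"
    using N.prob_compl[of "{..<b}"] by (simp add: Compl_eq_Diff_UNIV[symmetric])
  ultimately show ?thesis
    using prob_X[of "{b..}" i] by (simp add: gauss_tail_def Phi_def cdf_def)
qed

text \<open>Index 0 is left out because \<open>X 0\<close> is the common factor. With the common
  factor frozen, counts of small p-values become such counts.\<close>

definition exceed :: "nat \<Rightarrow> real \<Rightarrow> 'a \<Rightarrow> nat" where
  "exceed n b \<omega> = card {i\<in>{1..n}. b \<le> X i \<omega>}"

lemma exceed_measurable [measurable]: "(\<lambda>\<omega>. exceed n b \<omega>) \<in> measurable M (count_space UNIV)"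
  unfolding exceed_def by measurable

lemma
  assumes "0 < n" "0 \<le> \<epsilon>"
  shows exceed_ge: "prob {\<omega>\<in>space M. real n * (gauss_tail b + \<epsilon>) \<le> real (exceed n b \<omega>)}
      \<le> exp (- 2 * \<epsilon>\<^sup>2 * real n)"
    and exceed_le: "prob {\<omega>\<in>space M. real (exceed n b \<omega>) \<le> real n * (gauss_tail b - \<epsilon>)}
      \<le> exp (- 2 * \<epsilon>\<^sup>2 * real n)"
proof -
  define Y where "Y = (\<lambda>i \<omega>. indicator {b..} (X i \<omega>) :: real)"
  have [measurable]: "Y i \<in> borel_measurable M" for i by (simp add: Y_def)
  have mu: "expectation (Y 0) = gauss_tail b"
  proof -
    have "expectation (Y 0) = expectation (indicator {\<omega>\<in>space M. b \<le> X 0 \<omega>})"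
      by (intro Bochner_Integration.integral_cong) (auto simp: Y_def indicator_def)
    also have "\<dots> = gauss_tail b" by (simp add: prob_X_ge Int_absorb2 subset_iff)
    finally show ?thesis .
  qed
  \<comment> \<open>\<open>Y 0\<close> only represents the common law; it is not one of the
    summands.\<close>
  interpret H: Hoeffding_ineq_iid M "{1..n}" Y "Y 0" 0 1 "gauss_tail b"
  proof unfold_locales
    show "indep_vars (\<lambda>_. borel) Y {1..n}"
      unfolding Y_def
      by (rule indep_vars_compose2[OF indep_vars_subset[OF indep]]) auto
    show "distr M borel (Y i) = distr M borel (Y 0)" for i
    proof -
      have "distr M borel (Y i) = distr (distr M lborel (X i)) borel (indicator {b..})" for i
        by (subst distr_distr) (auto simp: Y_def o_def)
      thus ?thesis by (simp add: distributed_distr_eq_density[OF normal])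
    qed
    show "AE \<omega> in M. Y 0 \<omega> \<in> {0..1}"
      by (rule AE_I2) (simp add: Y_def indicator_def)
  qed (simp_all add: mu)
  have S: "(\<Sum>i\<in>{1..n}. Y i \<omega>) = real (exceed n b \<omega>)" for \<omega>
    by (simp add: Y_def exceed_def indicator_def sum.If_cases Int_def)
  have e: "- 2 * (real n * \<epsilon>)\<^sup>2 / (real n * (1 - 0)\<^sup>2) = - 2 * \<epsilon>\<^sup>2 * real n"
    using assms by (simp add: power2_eq_square field_simps)
  show "prob {\<omega>\<in>space M. real n * (gauss_tail b + \<epsilon>) \<le> real (exceed n b \<omega>)}
      \<le> exp (- 2 * \<epsilon>\<^sup>2 * real n)"
    using H.Hoeffding_ineq_ge[of "real n * \<epsilon>"] assms e unfolding S by (simp add: distrib_left)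
  show "prob {\<omega>\<in>space M. real (exceed n b \<omega>) \<le> real n * (gauss_tail b - \<epsilon>)}
      \<le> exp (- 2 * \<epsilon>\<^sup>2 * real n)"
    using H.Hoeffding_ineq_le[of "real n * \<epsilon>"] assms e unfolding S by (simp add: right_diff_distrib)
qed

lemma prob_exceed_upper:
  assumes "gauss_tail b < c" and k: "(\<lambda>n. real (k n) / real n) \<longlonglongrightarrow> 0"
  shows "(\<lambda>n. prob {\<omega>\<in>space M. real n * c \<le> real (k n) + real (exceed n b \<omega>)}) \<longlonglongrightarrow> 0"
proof (rule tendsto_sandwich[OF _ _ tendsto_const])
  \<comment> \<open>Half of the slack absorbs \<open>k n\<close>, which is o(n); the other half
    feeds Hoeffding's inequality.\<close>
  define \<epsilon> where "\<epsilon> = (c - gauss_tail b) / 2"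
  have \<epsilon>: "0 < \<epsilon>" using assms by (simp add: \<epsilon>_def)
  show "eventually (\<lambda>n. prob {\<omega>\<in>space M. real n * c \<le> real (k n) + real (exceed n b \<omega>)}
      \<le> exp (- 2 * \<epsilon>\<^sup>2 * real n)) sequentially"
    using order_tendstoD(2)[OF k \<epsilon>] eventually_gt_at_top[of 0]
  proof eventually_elim
    case (elim n)
    have kn: "real (k n) \<le> real n * \<epsilon>" using elim by (simp add: field_simps)
    have c: "real n * c = real n * (gauss_tail b + \<epsilon>) + real n * \<epsilon>"
      by (simp add: \<epsilon>_def field_simps)
    have "prob {\<omega>\<in>space M. real n * c \<le> real (k n) + real (exceed n b \<omega>)}
        \<le> prob {\<omega>\<in>space M. real n * (gauss_tail b + \<epsilon>) \<le> real (exceed n b \<omega>)}"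
      using kn c by (intro finite_measure_mono) auto
    also have "\<dots> \<le> exp (- 2 * \<epsilon>\<^sup>2 * real n)" using elim \<epsilon> by (intro exceed_ge) auto
    finally show ?case .
  qed
  show "(\<lambda>n. exp (- 2 * \<epsilon>\<^sup>2 * real n)) \<longlonglongrightarrow> 0"
    using \<epsilon> by real_asymp
qed auto

lemma prob_exceed_lower:
  assumes "c < gauss_tail b"
  shows "(\<lambda>n. prob {\<omega>\<in>space M. real (exceed n b \<omega>) \<le> real n * c}) \<longlonglongrightarrow> 0"
proof (rule tendsto_sandwich[OF _ _ tendsto_const])
  define \<epsilon> where "\<epsilon> = gauss_tail b - c"
  have \<epsilon>: "0 < \<epsilon>" using assms by (simp add: \<epsilon>_def)
  show "eventually (\<lambda>n. prob {\<omega>\<in>space M. real (exceed n b \<omega>) \<le> real n * c}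
      \<le> exp (- 2 * \<epsilon>\<^sup>2 * real n)) sequentially"
    using eventually_gt_at_top[of 0]
  proof eventually_elim
    case (elim n)
    thus ?case using exceed_le[of n \<epsilon> b] \<epsilon> by (simp add: \<epsilon>_def)
  qed
  show "(\<lambda>n. exp (- 2 * \<epsilon>\<^sup>2 * real n)) \<longlonglongrightarrow> 0"
    using \<epsilon> by real_asymp
qed auto

lemma expectation_trunc_inverse:
  assumes "0 \<le> r" "r < 1"
  shows "integrable M (\<lambda>\<omega>. trunc_inverse \<epsilon> (gauss_tail (r * X i \<omega> + d)))"
    and "expectation (\<lambda>\<omega>. trunc_inverse \<epsilon> (gauss_tail (r * X i \<omega> + d)))
      = (\<integral>z. std_normal_density z * trunc_inverse \<epsilon> (gauss_tail (r * z + d)) \<partial>lborel)"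
proof -
  show "expectation (\<lambda>\<omega>. trunc_inverse \<epsilon> (gauss_tail (r * X i \<omega> + d)))
      = (\<integral>z. std_normal_density z * trunc_inverse \<epsilon> (gauss_tail (r * z + d)) \<partial>lborel)"
    by (rule distributed_integral[OF normal, symmetric]) auto
  have "integrable lborel (\<lambda>z. std_normal_density z * trunc_inverse \<epsilon> (gauss_tail (r * z + d)))"
    using gauss_tail_pos
    by (intro Bochner_Integration.integrable_bound[OF integrable_inverse_gauss_tail[OF assms, of d]] AE_I2)
      (auto simp: trunc_inverse_def abs_mult less_imp_le)
  thus "integrable M (\<lambda>\<omega>. trunc_inverse \<epsilon> (gauss_tail (r * X i \<omega> + d)))"
    by (subst (asm) distributed_integrable[OF normal]) auto
qed

section \<open>Asymptotic bounds for the false discovery rate\<close>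

lemma pval_eq:
  "pval \<rho> T X i \<omega> = (if i \<in> T then gauss_tail (sqrt (1 - \<rho>) * X i \<omega> - sqrt \<rho> * X 0 \<omega>) else 0)"
  by (simp add: pval_def gauss_tail_def)

lemma pval_measurable [measurable]: "(\<lambda>\<omega>. pval \<rho> T X i \<omega>) \<in> borel_measurable M"
  unfolding pval_eq by (cases "i \<in> T") simp_all

lemma FDP_pval_measurable [measurable]:
  "(\<lambda>\<omega>. FDP \<alpha> n T (\<lambda>i. pval \<rho> T X i \<omega>)) \<in> borel_measurable M"
  by (rule FDP_measurable) simp

lemma FDP_pval_integrable: "integrable M (\<lambda>\<omega>. FDP \<alpha> n T (\<lambda>i. pval \<rho> T X i \<omega>))"
  by (rule integrable_const_bound[of _ 1]) (auto simp: FDP_nonneg FDP_le_1)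

lemma FDR_eq: "FDR M X \<alpha> \<rho> n T = expectation (\<lambda>\<omega>. FDP \<alpha> n T (\<lambda>i. pval \<rho> T X i \<omega>))"
  by (simp add: FDR_def FDP_def)

text \<open>When \<open>X 0 \<le> x\<close>, every p-value is at most its value with the common
  factor frozen at \<open>x\<close>, and these frozen values cross the rejection line with
  probability tending to 1. The proportion is then at least \<open>1 - e n\<close>, so the limit
  inferior is at least \<open>Phi x\<close>.\<close>

lemma FDR_lower:
  fixes T :: "nat \<Rightarrow> nat set"
  assumes "0 < \<alpha>" "0 < \<rho>" "\<rho> < 1" "\<And>n. T n \<subseteq> {1..n}"
    and k: "(\<lambda>n. real (n - card (T n)) / real n) \<longlonglongrightarrow> 0"
    and x: "x \<in> supercritical \<alpha> \<rho>" and l: "l < Phi x"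
  shows "eventually (\<lambda>n. l < FDR M X \<alpha> \<rho> n (T n)) sequentially"
proof -
  define r where "r = sqrt (1 - \<rho>)"
  define s where "s = sqrt \<rho>"
  have r: "0 < r" and s: "0 < s" using assms by (auto simp: r_def s_def)
  obtain a where a: "gauss_tail a < \<alpha> * gauss_tail ((a + s * x) / r)"
    using x by (auto simp: supercritical_def r_def s_def)
  \<comment> \<open>The level that \<open>X i\<close> must reach for a p-value of at most
    \<open>t\<close> when the common factor is \<open>x\<close>.\<close>
  define b where "b = (a + s * x) / r"
  define t where "t = gauss_tail a"
  define bad where "bad = (\<lambda>n. {\<omega>\<in>space M. real (exceed n b \<omega>) \<le> real n * (t / \<alpha>)})"
  have t: "0 < t" by (simp add: t_def gauss_tail_pos)
  have [measurable]: "bad n \<in> sets M" for n unfolding bad_def by measurable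
  have "t / \<alpha> < gauss_tail b" using a assms by (simp add: t_def b_def field_simps)
  hence bad0: "(\<lambda>n. prob (bad n)) \<longlonglongrightarrow> 0"
    unfolding bad_def by (rule prob_exceed_lower)
  define e where "e = (\<lambda>n. real (n - card (T n)) * \<alpha> / (real n * t))"
  have "(\<lambda>n. (real (n - card (T n)) / real n) * (\<alpha> / t)) \<longlonglongrightarrow> 0 * (\<alpha> / t)"
    by (intro tendsto_mult k tendsto_const)
  hence e0: "e \<longlonglongrightarrow> 0" by (simp add: e_def)
  have lower: "Phi x - prob (bad n) - e n \<le> FDR M X \<alpha> \<rho> n (T n)" if n: "0 < n" for n
  proof -
    let ?A = "{\<omega>\<in>space M. X 0 \<omega> \<le> x}"
    have pt: "indicator ?A \<omega> - indicator (bad n) \<omega> - e n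
        \<le> FDP \<alpha> n (T n) (\<lambda>i. pval \<rho> (T n) X i \<omega>)" if \<omega>: "\<omega> \<in> space M" for \<omega>
    proof (cases "\<omega> \<in> ?A \<and> \<omega> \<notin> bad n")
      case True
      have "exceed n b \<omega> \<le> card {i\<in>{1..n}. pval \<rho> (T n) X i \<omega> \<le> t}"
        unfolding exceed_def
      proof (rule card_mono)
        have "gauss_tail (r * X i \<omega> - s * X 0 \<omega>) \<le> t" if "b \<le> X i \<omega>" for i
        proof -
          have "a + s * x \<le> r * X i \<omega>" using that r by (simp add: b_def field_simps)
          moreover have "s * X 0 \<omega> \<le> s * x" using True s by (intro mult_left_mono) auto
          ultimately show ?thesis by (simp add: t_def gauss_tail_le_iff)
        qed
        \<comment> \<open>Indices outside \<open>T n\<close> have p-value 0, which is below the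
          positive \<open>t\<close>.\<close>
        thus "{i\<in>{1..n}. b \<le> X i \<omega>} \<subseteq> {i\<in>{1..n}. pval \<rho> (T n) X i \<omega> \<le> t}"
          using t by (auto simp: pval_eq r_def s_def)
      qed simp
      moreover have "real n * t / \<alpha> \<le> real (exceed n b \<omega>)"
        using True \<omega> by (simp add: bad_def)
      ultimately have "real n * t / \<alpha> \<le> real (card {i\<in>{1..n}. pval \<rho> (T n) X i \<omega> \<le> t})"
        by linarith
      hence "1 - e n \<le> FDP \<alpha> n (T n) (\<lambda>i. pval \<rho> (T n) X i \<omega>)"
        unfolding e_def by (intro FDP_ge assms(1,4) n t)
      thus ?thesis using True by simp
    next
      case False
      hence "indicator ?A \<omega> - indicator (bad n) \<omega> \<le> (0::real)"
        by (auto simp: indicator_def)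
      moreover have "0 \<le> e n" using assms t by (simp add: e_def)
      ultimately show ?thesis
        using FDP_nonneg[of \<alpha> n "T n" "\<lambda>i. pval \<rho> (T n) X i \<omega>"] by linarith
    qed
    have "Phi x - prob (bad n) - e n
        = expectation (\<lambda>\<omega>. indicator ?A \<omega> - indicator (bad n) \<omega> - e n)"
      using prob_X_le[of 0 x] by (simp add: prob_space emeasure_eq_measure)
    also have "\<dots> \<le> FDR M X \<alpha> \<rho> n (T n)"
      unfolding FDR_eq using pt
      by (intro integral_mono FDP_pval_integrable) (auto simp: emeasure_eq_measure)
    finally show ?thesis .
  qed
  have "(\<lambda>n. Phi x - prob (bad n) - e n) \<longlonglongrightarrow> Phi x - 0 - 0"
    by (intro tendsto_diff tendsto_const bad0 e0)
  hence "eventually (\<lambda>n. l < Phi x - prob (bad n) - e n) sequentially"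
    by (rule order_tendstoD(1)) (use l in simp)
  thus ?thesis
    using eventually_gt_at_top[of 0]
  proof eventually_elim
    case (elim n)
    thus ?case using lower[of n] by linarith
  qed
qed

text \<open>When \<open>X 0 > x\<close>, the true p-values dominate values
  \<open>q \<omega> i\<close> computed with the common factor frozen at \<open>x\<close>. Those stay
  below the rejection line at all thresholds between \<epsilon> and \<alpha> outside a negligible
  event. There the threshold is at most \<epsilon>, and the proportion is at most \<open>S\<close>,
  whose mean \<open>\<alpha> * J \<epsilon>\<close> is below \<open>u - Phi x\<close>.\<close>

lemma FDR_upper:
  fixes T :: "nat \<Rightarrow> nat set"
  assumes "0 < \<alpha>" "\<alpha> < 1" "0 < \<rho>" "\<rho> < 1" "\<And>n. T n \<subseteq> {1..n}"
    and k: "(\<lambda>n. real (n - card (T n)) / real n) \<longlonglongrightarrow> 0"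
    and x': "x' \<notin> supercritical \<alpha> \<rho>" "x' < x" and u: "Phi x < u"
  shows "eventually (\<lambda>n. FDR M X \<alpha> \<rho> n (T n) < u) sequentially"
proof -
  define r where "r = sqrt (1 - \<rho>)"
  define s where "s = sqrt \<rho>"
  have r: "0 < r" "r < 1" and s: "0 < s" using assms by (auto simp: r_def s_def)
  define J where
    "J = (\<lambda>\<epsilon>. \<integral>z. std_normal_density z * trunc_inverse \<epsilon> (gauss_tail (r * z + - (s * x))) \<partial>lborel)"
  obtain \<epsilon> where \<epsilon>: "0 < \<epsilon>" "\<epsilon> < \<alpha>" and J: "J \<epsilon> < (u - Phi x) / \<alpha>"
    unfolding J_def
    by (rule integral_trunc_inverse_small[of r "(u - Phi x) / \<alpha>" \<alpha> "- (s * x)"])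
      (use r u assms in auto)
  \<comment> \<open>No threshold exceeds \<alpha>, as \<open>m \<le> n\<close>; those above
    \<epsilon> therefore have arguments in \<open>[lo, hi)\<close>.\<close>
  obtain lo where lo: "gauss_tail lo = \<alpha>" using gauss_tail_surj[of \<alpha>] assms by auto
  obtain hi where hi: "gauss_tail hi = \<epsilon>" using gauss_tail_surj[of \<epsilon>] \<epsilon> assms by auto
  \<comment> \<open>Only half of the slack is spent on the grid step, which keeps the comparison below strict.\<close>
  define \<eta> where "\<eta> = s * (x - x') / 2"
  have \<eta>: "0 < \<eta>" using s x' by (simp add: \<eta>_def)
  \<comment> \<open>The grid is equally spaced in the argument of \<open>gauss_tail\<close>, where
    passing from \<open>x'\<close> to \<open>x\<close> is a constant shift.\<close>
  define grid where "grid = (\<lambda>j::nat. lo + real j * \<eta>)"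
  obtain K :: nat where K: "(hi - lo) / \<eta> < real K" using reals_Archimedean2 by blast
  define g where "g = (\<lambda>a. (a + s * x) / r)"
  \<comment> \<open>On cell \<open>j\<close> the threshold is smallest at the right end and the
    count largest at the left end, so finitely many events control all thresholds in the
    range.\<close>
  define bad1 where "bad1 = (\<lambda>n j. {\<omega>\<in>space M. real n * (gauss_tail (grid (Suc j)) / \<alpha>)
      \<le> real (n - card (T n)) + real (exceed n (g (grid j)) \<omega>)})"
  define bad where "bad = (\<lambda>n. \<Union>j<K. bad1 n j)"
  have bad1_meas [measurable]: "bad1 n j \<in> sets M" for n j unfolding bad1_def by measurable
  have [measurable]: "bad n \<in> sets M" for n unfolding bad_def by measurable
  have "(\<lambda>n. prob (bad1 n j)) \<longlonglongrightarrow> 0" for j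
    unfolding bad1_def
  proof (rule prob_exceed_upper[OF _ k])
    have "grid (Suc j) + s * x' < grid j + s * x"
      using \<eta> by (simp add: grid_def \<eta>_def field_simps)
    hence "gauss_tail (g (grid j)) < gauss_tail ((grid (Suc j) + s * x') / r)"
      using r by (simp add: g_def gauss_tail_less_iff divide_strict_right_mono)
    also have "\<dots> \<le> gauss_tail (grid (Suc j)) / \<alpha>"
      using x'(1) assms(1) by (auto simp: supercritical_def r_def s_def not_less field_simps)
    finally show "gauss_tail (g (grid j)) < gauss_tail (grid (Suc j)) / \<alpha>" .
  qed
  hence "(\<lambda>n. \<Sum>j<K. prob (bad1 n j)) \<longlonglongrightarrow> (\<Sum>j<K. 0)" by (intro tendsto_sum)
  hence bad0: "(\<lambda>n. \<Sum>j<K. prob (bad1 n j)) \<longlonglongrightarrow> 0" by simp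
  have upper: "FDR M X \<alpha> \<rho> n (T n) \<le> Phi x + (\<Sum>j<K. prob (bad1 n j)) + \<alpha> * J \<epsilon>" if n: "0 < n" for n
  proof -
    let ?A = "{\<omega>\<in>space M. X 0 \<omega> \<le> x}"
    define q where "q = (\<lambda>\<omega> i. gauss_tail (r * X i \<omega> + - (s * x)))"
    define S where "S = (\<lambda>\<omega>. \<alpha> / real n * (\<Sum>i=1..n. trunc_inverse \<epsilon> (q \<omega> i)))"
    have S0: "0 \<le> S \<omega>" for \<omega>
      unfolding S_def trunc_inverse_def q_def using assms(1) gauss_tail_pos
      by (intro mult_nonneg_nonneg sum_nonneg) (auto intro: less_imp_le)
    have pt: "FDP \<alpha> n (T n) (\<lambda>i. pval \<rho> (T n) X i \<omega>)
        \<le> indicator ?A \<omega> + indicator (bad n) \<omega> + S \<omega>" if \<omega>: "\<omega> \<in> space M" for \<omega>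
    proof (cases "\<omega> \<in> ?A \<or> \<omega> \<in> bad n")
      case True
      hence "1 \<le> indicator ?A \<omega> + (indicator (bad n) \<omega> :: real)"
        by (auto simp: indicator_def)
      thus ?thesis using S0[of \<omega>] FDP_le_1[of \<alpha> n "T n" "\<lambda>i. pval \<rho> (T n) X i \<omega>"] by linarith
    next
      case False
      define p where "p = (\<lambda>i. pval \<rho> (T n) X i \<omega>)"
      define m where "m = su_index \<alpha> n p"
      have qp: "q \<omega> i \<le> p i" if "i \<in> T n" for i
      proof -
        have "s * x \<le> s * X 0 \<omega>" using False \<omega> s by (intro mult_left_mono) auto
        thus ?thesis using that
          by (simp add: q_def p_def pval_eq gauss_tail_le_iff r_def[symmetric] s_def[symmetric])
      qed
      have "real m * \<alpha> / real n \<le> \<epsilon>"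
      proof (rule ccontr)
        assume t: "\<not> real m * \<alpha> / real n \<le> \<epsilon>"
        have "m \<le> n" unfolding m_def by (rule su_index_le)
        hence t_le: "real m * \<alpha> / real n \<le> \<alpha>" using n assms by (simp add: field_simps)
        obtain a where a: "gauss_tail a = real m * \<alpha> / real n"
          by (rule gauss_tail_surj[of "real m * \<alpha> / real n"]) (use t t_le \<epsilon> assms in auto)
        have "lo \<le> a" "a < hi"
          using t t_le gauss_tail_le_iff[of a lo] gauss_tail_less_iff[of hi a] lo hi a by auto
        \<comment> \<open>The grid cell containing \<open>a\<close>; \<open>lo \<le> a\<close> keeps
          the floor nonnegative.\<close>
        define j where "j = nat \<lfloor>(a - lo) / \<eta>\<rfloor>"
        have j: "real j \<le> (a - lo) / \<eta>" "(a - lo) / \<eta> < real j + 1"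
          using \<open>lo \<le> a\<close> \<eta> by (simp_all add: j_def)
        have grid_j: "grid j \<le> a" "a \<le> grid (Suc j)"
          using j \<eta> by (simp_all add: grid_def field_simps)
        have "(a - lo) / \<eta> < (hi - lo) / \<eta>" using \<open>a < hi\<close> \<eta> by (simp add: divide_strict_right_mono)
        with j(1) K have "j < K" by linarith
        have "card {i\<in>{1..n}. q \<omega> i \<le> real m * \<alpha> / real n} \<le> exceed n (g (grid j)) \<omega>"
          unfolding exceed_def
        proof (rule card_mono)
          have "g (grid j) \<le> X i \<omega>" if "q \<omega> i \<le> real m * \<alpha> / real n" for i
          proof -
            have "a \<le> r * X i \<omega> - s * x"
              using that by (simp add: q_def a[symmetric] gauss_tail_le_iff)
            thus ?thesis using grid_j(1) r by (simp add: g_def field_simps)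
          qed
          thus "{i\<in>{1..n}. q \<omega> i \<le> real m * \<alpha> / real n} \<subseteq> {i\<in>{1..n}. g (grid j) \<le> X i \<omega>}"
            by auto
        qed simp
        moreover have "m \<le> (n - card (T n)) + card {i\<in>{1..n}. q \<omega> i \<le> real m * \<alpha> / real n}"
          unfolding m_def using assms qp by (intro su_index_le_count) auto
        moreover have "real n * (gauss_tail (grid (Suc j)) / \<alpha>) \<le> real m"
        proof -
          have "gauss_tail (grid (Suc j)) \<le> real m * \<alpha> / real n"
            using grid_j(2) by (simp add: a[symmetric] gauss_tail_le_iff)
          thus ?thesis using assms n by (simp add: field_simps)
        qed
        ultimately have "\<omega> \<in> bad1 n j" using \<omega> by (simp add: bad1_def)
        with \<open>j < K\<close> False show False by (auto simp: bad_def)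
      qed
      hence "FDP \<alpha> n (T n) p \<le> S \<omega>"
        unfolding S_def trunc_inverse_def using assms qp
        by (intro FDP_le_sum) (auto simp: m_def q_def gauss_tail_pos)
      moreover have "(0::real) \<le> indicator ?A \<omega> + indicator (bad n) \<omega>" by simp
      ultimately show ?thesis unfolding p_def by linarith
    qed
    have int: "integrable M (\<lambda>\<omega>. trunc_inverse \<epsilon> (q \<omega> i))"
      and E: "expectation (\<lambda>\<omega>. trunc_inverse \<epsilon> (q \<omega> i)) = J \<epsilon>" for i
      unfolding q_def J_def by (rule expectation_trunc_inverse; use r in simp)+
    have intS: "integrable M S" unfolding S_def by (intro integrable_mult_right Bochner_Integration.integrable_sum int)
    have ES: "expectation S = \<alpha> * J \<epsilon>"
      unfolding S_def using n by (simp add: Bochner_Integration.integral_sum int E)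
    have "FDR M X \<alpha> \<rho> n (T n)
        \<le> expectation (\<lambda>\<omega>. indicator ?A \<omega> + indicator (bad n) \<omega> + S \<omega>)"
      unfolding FDR_eq using pt
      by (intro integral_mono FDP_pval_integrable Bochner_Integration.integrable_add intS)
        (auto simp: emeasure_eq_measure)
    also have "\<dots> = Phi x + prob (bad n) + \<alpha> * J \<epsilon>"
      using prob_X_le[of 0 x] intS ES by (simp add: emeasure_eq_measure)
    also have "prob (bad n) \<le> (\<Sum>j<K. prob (bad1 n j))"
      unfolding bad_def by (rule finite_measure_subadditive_finite) auto
    finally show ?thesis by simp
  qed
  have "(\<lambda>n. Phi x + (\<Sum>j<K. prob (bad1 n j)) + \<alpha> * J \<epsilon>) \<longlonglongrightarrow> Phi x + 0 + \<alpha> * J \<epsilon>"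
    by (intro tendsto_add tendsto_const bad0)
  hence "eventually (\<lambda>n. Phi x + (\<Sum>j<K. prob (bad1 n j)) + \<alpha> * J \<epsilon> < u) sequentially"
    by (rule order_tendstoD(2)) (use J assms in \<open>simp add: field_simps\<close>)
  thus ?thesis
    using eventually_gt_at_top[of 0]
  proof eventually_elim
    case (elim n)
    thus ?case using upper[of n] by linarith
  qed
qed

text \<open>Continuity of \<open>Phi\<close> at the critical point allows both one-sided bounds to
  be applied at nearby points, avoiding the critical point itself.\<close>

lemma FDR_tendsto:
  fixes T :: "nat \<Rightarrow> nat set"
  assumes "0 < \<alpha>" "\<alpha> \<le> 1/2" "0 < \<rho>" "\<rho> < 1" "\<And>n. T n \<subseteq> {1..n}"
    and k: "(\<lambda>n. real (n - card (T n)) / real n) \<longlonglongrightarrow> 0"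
  shows "(\<lambda>n. FDR M X \<alpha> \<rho> n (T n)) \<longlonglongrightarrow> Phi (critical_point \<alpha> \<rho>)"
proof (rule order_tendstoI)
  define c where "c = critical_point \<alpha> \<rho>"
  have cont: "(Phi \<longlongrightarrow> Phi c) (at c within S)" for S
    using isCont_Phi[of c] by (auto simp: isCont_def intro: tendsto_within_subset)
  show "eventually (\<lambda>n. l < FDR M X \<alpha> \<rho> n (T n)) sequentially"
    if "l < Phi (critical_point \<alpha> \<rho>)" for l
  proof -
    have "eventually (\<lambda>x. l < Phi x \<and> x < c) (at_left c)"
      using order_tendstoD(1)[OF cont[of "{..<c}"] that[folded c_def]]
      by (intro eventually_conj) (auto simp: eventually_at_filter)
    then obtain x where "l < Phi x" "x < c"
      using eventually_happens[of _ "at_left c"] by auto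
    thus ?thesis
      using assms by (intro FDR_lower[of _ _ _ x] supercritical_less) (auto simp: c_def)
  qed
  show "eventually (\<lambda>n. FDR M X \<alpha> \<rho> n (T n) < u) sequentially"
    if "Phi (critical_point \<alpha> \<rho>) < u" for u
  proof -
    have "eventually (\<lambda>x. Phi x < u \<and> c < x) (at_right c)"
      using order_tendstoD(2)[OF cont[of "{c<..}"] that[folded c_def]]
      by (intro eventually_conj) (auto simp: eventually_at_filter)
    then obtain x where x: "Phi x < u" "c < x"
      using eventually_happens[of _ "at_right c"] by auto
    \<comment> \<open>The intermediate point is already not supercritical and supplies the slack
      \<open>x - x'\<close> for the grid.\<close>
    obtain x' where x': "c < x'" "x' < x" using dense[OF x(2)] by blast
    show ?thesis
      using assms x x' by (intro FDR_upper[of _ _ _ x' x] supercritical_gr) (auto simp: c_def)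
  qed
qed

end

theorem theorem3p3:
  fixes M :: "'a measure" and X :: "nat \<Rightarrow> 'a \<Rightarrow> real"
    and \<alpha> :: real and T :: "nat \<Rightarrow> nat set"
  assumes "prob_space M"
    and "prob_space.indep_vars M (\<lambda>_. borel) X UNIV"
    and "\<And>i. distributed M lborel (X i) std_normal_density"
    and "0 < \<alpha>" and "\<alpha> \<le> 1/2"
    and "\<And>n. T n \<subseteq> {1..n}"
    and "(\<lambda>n. real (card (T n)) / real n) \<longlonglongrightarrow> 1"
  shows "\<exists>F :: real \<Rightarrow> real.
           (\<forall>\<rho>\<in>{0<..<1}. (\<lambda>n. FDR M X \<alpha> \<rho> n (T n)) \<longlonglongrightarrow> F \<rho>) \<and>
           (F \<longlongrightarrow> Phi (- sqrt (- 2 * ln \<alpha>))) (at_right 0)"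
proof (intro exI[of _ "\<lambda>\<rho>. Phi (critical_point \<alpha> \<rho>)"] conjI ballI)
  interpret iid_std_normal M X
    by (intro iid_std_normal.intro iid_std_normal_axioms.intro assms)
  have "(\<lambda>n. 1 - real (card (T n)) / real n) \<longlonglongrightarrow> 1 - 1"
    by (intro tendsto_diff tendsto_const assms)
  \<comment> \<open>At \<open>n = 0\<close> the left side is 1 and the right side 0, so the identity
    is claimed only eventually.\<close>
  moreover have ev: "eventually (\<lambda>n. 1 - real (card (T n)) / real n = real (n - card (T n)) / real n)
      sequentially"
    using eventually_gt_at_top[of 0]
  proof eventually_elim
    case (elim n)
    have "card (T n) \<le> card {1..n}" by (intro card_mono assms) simp
    thus ?case using elim by (simp add: of_nat_diff field_simps)
  qed
  ultimately have k: "(\<lambda>n. real (n - card (T n)) / real n) \<longlonglongrightarrow> 0"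
    using tendsto_cong[OF ev] by simp
  show "(\<lambda>n. FDR M X \<alpha> \<rho> n (T n)) \<longlonglongrightarrow> Phi (critical_point \<alpha> \<rho>)" if "\<rho> \<in> {0<..<1}" for \<rho>
    using that assms k by (intro FDR_tendsto) auto
  show "((\<lambda>\<rho>. Phi (critical_point \<alpha> \<rho>)) \<longlongrightarrow> Phi (- sqrt (- 2 * ln \<alpha>))) (at_right 0)"
    by (rule isCont_tendsto_compose[OF isCont_Phi critical_point_tendsto]) (use assms in auto)
qed

end
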